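(* Let $d(x)\in\mathbb{Z}[x]$ be monic, quartic and not square-free. Then $d(x)$ is Pellian over $\mathbb{Z}[x]$ if and only if, up to a change of variables $x\mapsto \pm x+c$ with $c\in\mathbb{Z}$, $d(x)$ is one of \begin{itemize} \item $x^2(x^2\pm 1)$, \item $x^2(x^2\pm 2)$, \item $x^2(x^2-2x-1)$. \end{itemize}
   Context: For a commutative ring $R$ with unity, a non-square polynomial $d(x)\in R[x]$ is called Pellian over $R[x]$ if there exist $f(x),g(x)\in R[x]$ with $g(x)\neq 0$ and $f(x)^2-d(x)g(x)^2=1$. *)

theory Defs
  imports "HOL-Computational_Algebra.Computational_Algebra"
begin

text \<open>The ground ring \<open>R\<close> is the coefficient type \<open>'a\<close>, and \<open>is_square d\<close> says that \<open>d\<close> is the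
  square of an element of \<open>R[x]\<close>.\<close>

definition pellian :: "'a::comm_ring_1 poly \<Rightarrow> bool" where
  "pellian d \<longleftrightarrow> \<not> is_square d \<and> (\<exists>f g. g \<noteq> 0 \<and> f ^ 2 - d * g ^ 2 = 1)"

text \<open>The polynomial \<open>[:c, s:]\<close> is \<open>c + s x\<close>. The substitutions \<open>x \<mapsto> \<plusminus>x + c\<close> with integral \<open>c\<close> form
  a group, so it does not matter to which of the two polynomials the substitution is applied.\<close>

definition equal_up_to_change_of_variables :: "int poly \<Rightarrow> int poly \<Rightarrow> bool" where
  "equal_up_to_change_of_variables p q \<longleftrightarrow> (\<exists>c. \<exists>s\<in>{1, -1}. p \<circ>\<^sub>p [:c, s:] = q)"

abbreviation X :: "int poly" where
  "X \<equiv> [:0, 1:]"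

end

theory Submission
  imports Defs
begin

text \<open>
  If \<open>p\<^sup>2\<close> divides \<open>d\<close> for a non-unit \<open>p\<close>, then \<open>p\<close> is linear unless \<open>d\<close> is a square, so
  after a translation \<open>d = x\<^sup>2 e\<close> with \<open>e = x\<^sup>2 + b x + c\<close>. A solution of the Pell equation for
  \<open>d\<close> is then a pair \<open>f, h\<close> with \<open>f\<^sup>2 - e h\<^sup>2 = 1\<close> and \<open>h(0) = 0\<close>. Put \<open>z = 2 x + b\<close> and
  \<open>D = b\<^sup>2 - 4 c\<close>; then \<open>z + 2 \<surd>e\<close> has norm \<open>z\<^sup>2 - 4 e = D\<close>, and multiplying by its conjugate
  lowers degrees, so \<open>f + h \<surd>e\<close> is a rational multiple of \<open>(z \<plusminus> 2 \<surd>e)\<^sup>n = A\<^sub>n \<plusminus> B\<^sub>n \<surd>e\<close>.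
  Comparing norms and the leading coefficient \<open>2\<^bsup>2n-1\<^esup>\<close> of \<open>A\<^sub>n\<close> shows that \<open>D\<^sup>n\<close> divides
  \<open>2\<^bsup>4n-2\<^esup>\<close>, hence \<open>D\<close> is one of \<open>1, \<plusminus>4, \<plusminus>8\<close>. If \<open>b \<noteq> 0\<close> and \<open>c \<ge> 0\<close>, then no cancellation occurs
  in the recursion for \<open>B\<^sub>n(0)\<close>, so \<open>h(0) \<noteq> 0\<close>. Hence \<open>b = 0\<close> or \<open>b\<^sup>2 < D\<close>, and finitely many
  pairs \<open>(b, c)\<close> remain.
\<close>

section \<open>Powers of \<open>z + 2 \<surd>e\<close>\<close>

text \<open>The coordinates of \<open>(z + 2 sqrt e)^n\<close> with respect to \<open>1\<close> and
  \<open>sqrt e\<close>. An arbitrary ring lets one recursion serve both polynomials and their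
  values at 0.\<close>

fun quad_A quad_B :: "'a::comm_ring_1 \<Rightarrow> 'a \<Rightarrow> nat \<Rightarrow> 'a" where
  "quad_A z e 0 = 1"
| "quad_B z e 0 = 0"
| "quad_A z e (Suc n) = z * quad_A z e n + 2 * e * quad_B z e n"
| "quad_B z e (Suc n) = 2 * quad_A z e n + z * quad_B z e n"

lemma quad_norm: "quad_A z e n ^ 2 - e * quad_B z e n ^ 2 = (z ^ 2 - 4 * e) ^ n"
proof (induction n)
  case (Suc n)
  have "quad_A z e (Suc n) ^ 2 - e * quad_B z e (Suc n) ^ 2 =
      (z ^ 2 - 4 * e) * (quad_A z e n ^ 2 - e * quad_B z e n ^ 2)"
    by (simp add: power2_eq_square algebra_simps)
  then show ?case
    using Suc by simp
qed simp

lemma poly_quad: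
  "poly (quad_A z e n) x = quad_A (poly z x) (poly e x) n"
  "poly (quad_B z e n) x = quad_B (poly z x) (poly e x) n"
  by (induction n) (simp_all)

text \<open>In each coordinate of \<open>(b + 2 sqrt c)^n\<close> the exponents of \<open>b\<close>
  have one parity; the factors \<open>b ^ n\<close> and \<open>b ^ Suc n\<close> make them even, so
  every term is nonnegative whatever the sign of \<open>b\<close>.\<close>

lemma quad_sign:
  fixes b c :: "'a::linordered_idom"
  assumes "b \<noteq> 0" "c \<ge> 0"
  shows "b ^ n * quad_A b c n > 0" and "b ^ Suc n * quad_B b c n \<ge> 0"
proof (induction n)
  case (Suc n)
  have b2: "b ^ 2 > 0" using assms by simp
  have "b ^ Suc n * quad_A b c (Suc n) =
      b ^ 2 * (b ^ n * quad_A b c n) + 2 * c * (b ^ Suc n * quad_B b c n)"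
    by (simp add: power2_eq_square algebra_simps)
  moreover have "b ^ 2 * (b ^ n * quad_A b c n) > 0"
    using b2 Suc(1) by (rule mult_pos_pos)
  moreover have "2 * c * (b ^ Suc n * quad_B b c n) \<ge> 0"
    using assms(2) Suc(2) by (metis mult_nonneg_nonneg zero_le_numeral)
  ultimately show "b ^ Suc n * quad_A b c (Suc n) > 0"
    by linarith
  have "b ^ Suc (Suc n) * quad_B b c (Suc n) =
      2 * (b ^ 2 * (b ^ n * quad_A b c n)) + b ^ 2 * (b ^ Suc n * quad_B b c n)"
    by (simp add: power2_eq_square algebra_simps)
  moreover have "b ^ 2 * (b ^ Suc n * quad_B b c n) \<ge> 0"
    using b2 Suc(2) by (metis mult_nonneg_nonneg less_imp_le)
  ultimately show "b ^ Suc (Suc n) * quad_B b c (Suc n) \<ge> 0"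
    using \<open>b ^ 2 * (b ^ n * quad_A b c n) > 0\<close> by linarith
qed auto

lemma quad_B_nonzero:
  fixes b c :: "'a::linordered_idom"
  assumes "b \<noteq> 0" "c \<ge> 0"
  shows "quad_B b c (Suc n) \<noteq> 0"
proof
  assume "quad_B b c (Suc n) = 0"
  then have "b * b ^ n * (2 * quad_A b c n + b * quad_B b c n) = 0" by simp
  then have "2 * (b * (b ^ n * quad_A b c n)) + b * (b ^ Suc n * quad_B b c n) = 0"
    by (simp add: algebra_simps)
  then have "b * (2 * (b ^ n * quad_A b c n) + b ^ Suc n * quad_B b c n) = 0"
    by (simp add: algebra_simps)
  then have "2 * (b ^ n * quad_A b c n) + b ^ Suc n * quad_B b c n = 0"
    using assms by simp
  then show False
    using quad_sign[OF assms, of n] by linarith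
qed

text \<open>Each new leading coefficient is twice the sum of the two old ones, so both quadruple.
  The index starts at \<open>Suc n\<close> because \<open>quad_B z e 0 = 0\<close> breaks the
  pattern.\<close>

lemma degree_quad:
  "degree (quad_A [:b, 2:] [:c, b, 1:] (Suc n)) \<le> Suc n \<and>
   degree (quad_B [:b, 2:] [:c, b, 1:] (Suc n)) \<le> n \<and>
   coeff (quad_A [:b, 2:] [:c, b, 1:] (Suc n)) (Suc n) = (2 ^ (2 * n + 1) :: int) \<and>
   coeff (quad_B [:b, 2:] [:c, b, 1:] (Suc n)) n = 2 ^ (2 * n + 1)"
proof (induction n)
  case 0
  show ?case by (simp add: numeral_poly)
next
  case (Suc n)
  define A where "A = quad_A [:b, 2:] [:c, b, 1:] (Suc n)"
  define B where "B = quad_B [:b, 2:] [:c, b, 1:] (Suc n)"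
  have IH: "degree A \<le> Suc n" "degree B \<le> n" "coeff A (Suc n) = 2 ^ (2 * n + 1)"
    "coeff B n = 2 ^ (2 * n + 1)"
    using Suc unfolding A_def B_def by auto
  have A': "quad_A [:b, 2:] [:c, b, 1:] (Suc (Suc n)) = [:b, 2:] * A + 2 * [:c, b, 1:] * B"
    and B': "quad_B [:b, 2:] [:c, b, 1:] (Suc (Suc n)) = 2 * A + [:b, 2:] * B"
    unfolding A_def B_def by (rule quad_A.simps quad_B.simps)+
  have high: "coeff A k = 0" if "k > Suc n" for k
    using that IH by (intro coeff_eq_0) auto
  have highB: "coeff B k = 0" if "k > n" for k
    using that IH by (intro coeff_eq_0) auto
  have cA: "coeff ([:b, 2:] * A + 2 * [:c, b, 1:] * B) (Suc (Suc k)) =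
      b * coeff A (Suc (Suc k)) + 2 * coeff A (Suc k)
      + 2 * (c * coeff B (Suc (Suc k)) + b * coeff B (Suc k) + coeff B k)" for k
    by (simp add: numeral_poly algebra_simps)
  have cB: "coeff (2 * A + [:b, 2:] * B) (Suc k) =
      2 * coeff A (Suc k) + b * coeff B (Suc k) + 2 * coeff B k" for k
    by (simp add: numeral_poly algebra_simps)
  have "degree ([:b, 2:] * A + 2 * [:c, b, 1:] * B) \<le> Suc (Suc n)"
  proof (rule degree_le, intro allI impI)
    fix i assume i: "i > Suc (Suc n)"
    then obtain k where "i = Suc (Suc k)" "k > n"
      by (metis Suc_less_eq Suc_lessE)
    then show "coeff ([:b, 2:] * A + 2 * [:c, b, 1:] * B) i = 0"
      unfolding \<open>i = _\<close> cA by (simp add: high highB)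
  qed
  moreover have "degree (2 * A + [:b, 2:] * B) \<le> Suc n"
  proof (rule degree_le, intro allI impI)
    fix i assume i: "i > Suc n"
    then obtain k where "i = Suc k" "k > n"
      by (metis Suc_lessE)
    then show "coeff (2 * A + [:b, 2:] * B) i = 0"
      unfolding \<open>i = _\<close> cB by (simp add: high highB)
  qed
  moreover have "coeff ([:b, 2:] * A + 2 * [:c, b, 1:] * B) (Suc (Suc n)) = 2 ^ (2 * Suc n + 1)"
    unfolding cA by (simp add: high highB IH)
  moreover have "coeff (2 * A + [:b, 2:] * B) (Suc n) = 2 ^ (2 * Suc n + 1)"
    unfolding cB by (simp add: highB IH)
  ultimately show ?case
    unfolding A' B' by blast
qed

section \<open>Descent for the Pell equation of a monic quadratic\<close>

text \<open>Proportionality over the fraction field, with denominators cleared to stay in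
  \<open>'a\<close>. A sign of \<open>f\<close> is absorbed by \<beta>; only the relative sign of
  \<open>h\<close> needs two cases.\<close>

definition proportional_to_quad :: "'a::idom \<Rightarrow> 'a \<Rightarrow> 'a poly \<Rightarrow> 'a poly \<Rightarrow> bool" where
  "proportional_to_quad b c f h \<longleftrightarrow> (\<exists>n \<alpha> \<beta>. \<alpha> \<noteq> 0 \<and> \<beta> \<noteq> 0 \<and>
     smult \<alpha> f = smult \<beta> (quad_A [:b, 2:] [:c, b, 1:] n) \<and>
     (smult \<alpha> h = smult \<beta> (quad_B [:b, 2:] [:c, b, 1:] n) \<or>
      smult \<alpha> h = - smult \<beta> (quad_B [:b, 2:] [:c, b, 1:] n)))"

lemma proportional_to_quad_uminus:
  "proportional_to_quad b c f (- h) \<longleftrightarrow> proportional_to_quad b c f h"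
  unfolding proportional_to_quad_def
  by (simp add: minus_equation_iff[of "smult _ h"]) (metis add.inverse_inverse)

lemma quad_discriminant: "[:b, 2:] ^ 2 - 4 * [:c, b, 1:] = [:b ^ 2 - 4 * c :: 'a::comm_ring_1:]"
  by (simp add: power2_eq_square numeral_poly)

text \<open>The assumption \<open>step\<close> concerns
  \<open>(f + h sqrt e) * (z - 2 sqrt e)\<close>; multiplying back by \<open>z + 2 sqrt e\<close>
  recovers \<open>f + h sqrt e\<close> up to the constant \<open>D\<close>.\<close>

lemma proportional_to_quad_step:
  fixes b c :: "'a::idom"
  assumes D: "b ^ 2 - 4 * c \<noteq> 0"
    and step: "proportional_to_quad b c
      ([:b, 2:] * f - 2 * [:c, b, 1:] * h) ([:b, 2:] * h - 2 * f)"
  shows "proportional_to_quad b c f h"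
proof -
  define z e where "z = [:b, 2:]" and "e = [:c, b, 1:]"
  define D where "D = b ^ 2 - 4 * c"
  define f' h' where "f' = z * f - 2 * e * h" and "h' = z * h - 2 * f"
  have disc: "z ^ 2 - 4 * e = [:D:]"
    unfolding z_def e_def D_def by (rule quad_discriminant)
  have smD: "smult D p = (z ^ 2 - 4 * e) * p" for p
    unfolding disc by simp
  have Df: "smult D f = z * f' + 2 * e * h'" and Dh: "smult D h = 2 * f' + z * h'"
    unfolding smD f'_def h'_def by (simp_all add: power2_eq_square algebra_simps)
  obtain n \<alpha> \<beta> where nz: "\<alpha> \<noteq> 0" "\<beta> \<noteq> 0"
    and f': "smult \<alpha> f' = smult \<beta> (quad_A z e n)"
    and h': "smult \<alpha> h' = smult \<beta> (quad_B z e n) \<or> smult \<alpha> h' = - smult \<beta> (quad_B z e n)"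
    using step unfolding proportional_to_quad_def f'_def h'_def z_def e_def by blast
  have f: "smult (\<alpha> * D) f = z * smult \<alpha> f' + 2 * e * smult \<alpha> h'"
    by (simp add: smult_smult[symmetric] Df smult_add_right del: smult_smult)
  have h: "smult (\<alpha> * D) h = 2 * smult \<alpha> f' + z * smult \<alpha> h'"
    by (simp add: smult_smult[symmetric] Dh smult_add_right del: smult_smult)
  have "D \<noteq> 0" using D by (simp add: D_def)
  \<comment> \<open>For \<open>n = 0\<close> both signs agree because
    \<open>quad_B z e 0 = 0\<close>, so the minus case may take \<open>n = Suc m\<close>.\<close>
  consider (plus) "smult \<alpha> h' = smult \<beta> (quad_B z e n)"
    | (minus) m where "n = Suc m" "smult \<alpha> h' = - smult \<beta> (quad_B z e n)"
    using h' by (cases n) auto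
  then show ?thesis
  proof cases
    case plus
    have "smult (\<alpha> * D) f = smult \<beta> (quad_A z e (Suc n))"
      "smult (\<alpha> * D) h = smult \<beta> (quad_B z e (Suc n))"
      unfolding f h f' plus by (simp_all add: smult_add_right)
    then show ?thesis
      unfolding proportional_to_quad_def z_def[symmetric] e_def[symmetric]
      using nz \<open>D \<noteq> 0\<close> by (metis mult_eq_0_iff)
  next
    case (minus m)
    \<comment> \<open>This is
      \<open>(z - 2 sqrt e)^n * (z + 2 sqrt e) = D * (z - 2 sqrt e)^m\<close>, by
      coordinates.\<close>
    have "z * quad_A z e n - 2 * e * quad_B z e n = smult D (quad_A z e m)"
      "2 * quad_A z e n - z * quad_B z e n = - smult D (quad_B z e m)"
      unfolding smD minus(1) by (simp_all add: power2_eq_square algebra_simps)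
    moreover have "smult (\<alpha> * D) f = smult \<beta> (z * quad_A z e n - 2 * e * quad_B z e n)"
      "smult (\<alpha> * D) h = smult \<beta> (2 * quad_A z e n - z * quad_B z e n)"
      unfolding f h f' minus(2) by (simp_all add: smult_diff_right)
    ultimately have "smult D (smult \<alpha> f) = smult D (smult \<beta> (quad_A z e m))"
      "smult D (smult \<alpha> h) = smult D (- smult \<beta> (quad_B z e m))"
      by (simp_all add: mult.commute)
    then have "smult \<alpha> f = smult \<beta> (quad_A z e m)" "smult \<alpha> h = - smult \<beta> (quad_B z e m)"
      using \<open>D \<noteq> 0\<close> by (metis smult_cancel)+
    then show ?thesis
      unfolding proportional_to_quad_def z_def[symmetric] e_def[symmetric] using nz by blast
  qed
qed

lemma pell_norm_step:
  fixes z e f h :: "'a::comm_ring_1"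
  shows "(z * f - 2 * e * h) ^ 2 - e * (z * h - 2 * f) ^ 2 = (z ^ 2 - 4 * e) * (f ^ 2 - e * h ^ 2)"
  by (simp add: power2_eq_square algebra_simps)

text \<open>Descent on the degree of \<open>h\<close>. Each step multiplies the norm by
  \<open>D\<close>, so the induction needs an arbitrary nonzero constant \<open>k\<close>.\<close>

lemma pell_solution_proportional_to_quad:
  fixes b c k :: "'a::{idom, ring_char_0}"
  assumes "b ^ 2 - 4 * c \<noteq> 0" "k \<noteq> 0" "f ^ 2 - [:c, b, 1:] * h ^ 2 = [:k:]"
  shows "proportional_to_quad b c f h"
  using assms(2,3)
\<comment> \<open>The measure puts \<open>h = 0\<close> strictly below the nonzero constants, which
  have the same \<open>degree\<close>.\<close>
proof (induction "if h = 0 then 0 else Suc (degree h)" arbitrary: f h k rule: less_induct)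
  case less
  define z e where "z = [:b, 2:]" and "e = [:c, b, 1:]"
  define D where "D = b ^ 2 - 4 * c"
  have disc: "z ^ 2 - 4 * e = [:D:]"
    unfolding z_def e_def D_def by (rule quad_discriminant)
  have "D \<noteq> 0" using assms(1) by (simp add: D_def)
  have norm: "f ^ 2 - e * h ^ 2 = [:k:]" using less.prems(2) by (simp add: e_def)
  show ?case
  proof (cases "h = 0")
    case True
    then have "f ^ 2 = [:k:]" using less.prems by simp
    then have "degree (f ^ 2) = 0" by simp
    then have "degree f = 0"
      by (cases "f = 0") (simp_all add: power2_eq_square degree_mult_eq)
    then obtain a where a: "f = [:a:]" by (rule degree_eq_zeroE)
    with \<open>f ^ 2 = [:k:]\<close> less.prems(1) have "a \<noteq> 0" by auto
    then have "smult 1 f = smult a (quad_A [:b, 2:] [:c, b, 1:] 0)"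
      "smult 1 h = smult a (quad_B [:b, 2:] [:c, b, 1:] 0)"
      using a True by auto
    then show ?thesis
      unfolding proportional_to_quad_def using \<open>a \<noteq> 0\<close> by (metis one_neq_zero)
  next
    case False
    have descend: "proportional_to_quad b c f h"
      if g: "g = h \<or> g = - h" and small: "z * g - 2 * f = 0 \<or> degree (z * g - 2 * f) < degree h" for g
    proof -
      have "(z * f - 2 * e * g) ^ 2 - e * (z * g - 2 * f) ^ 2 = [:D * k:]"
        unfolding pell_norm_step disc using norm g by auto
      moreover have "D * k \<noteq> 0" using \<open>D \<noteq> 0\<close> less.prems(1) by simp
      ultimately have "proportional_to_quad b c (z * f - 2 * e * g) (z * g - 2 * f)"
        using less.hyps[of "z * g - 2 * f" "D * k" "z * f - 2 * e * g"] small False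
        unfolding e_def[symmetric] by (auto split: if_splits)
      then have "proportional_to_quad b c f g"
        unfolding z_def e_def by (rule proportional_to_quad_step[OF assms(1)])
      then show ?thesis
        using g proportional_to_quad_uminus by metis
    qed
    \<comment> \<open>The new second coordinates obtained from \<open>h\<close> and
      \<open>- h\<close>. Their difference has degree \<open>degree h + 1\<close> but their product
      at most \<open>2 * degree h\<close>, so one of them is zero or of degree below
      \<open>degree h\<close>.\<close>
    define p q where "p = z * h - 2 * f" and "q = z * (- h) - 2 * f"
    have "p * q = 4 * (f ^ 2 - e * h ^ 2) - (z ^ 2 - 4 * e) * h ^ 2"
      unfolding p_def q_def by (simp add: power2_eq_square algebra_simps)
    then have "p * q = 4 * [:k:] - smult D (h ^ 2)"
      unfolding norm disc by simp
    then have "degree (p * q) \<le> 2 * degree h"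
      by (simp add: degree_diff_le numeral_poly degree_smult_le degree_power_eq False)
    have "p - q = 2 * (z * h)"
      unfolding p_def q_def by simp
    moreover have "z \<noteq> 0" "degree z = 1"
      by (simp_all add: z_def)
    ultimately have "degree (p - q) = Suc (degree h)"
      using False by (simp add: numeral_poly degree_mult_eq)
    then have "degree p > degree h \<or> degree q > degree h"
      using degree_diff_le_max[of p q] by linarith
    moreover have "degree p + degree q \<le> 2 * degree h" if "p \<noteq> 0" "q \<noteq> 0"
      using that \<open>degree (p * q) \<le> 2 * degree h\<close> by (simp add: degree_mult_eq)
    ultimately have "p = 0 \<or> q = 0 \<or> degree p < degree h \<or> degree q < degree h"
      by linarith
    then show ?thesis
      using descend[of h] descend[of "- h"] unfolding p_def q_def by blast
  qed
qed

section \<open>Integrality and vanishing at zero\<close>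

text \<open>If \<open>D\<close> is, up to sign, \<open>2 ^ j\<close>, then
  \<open>j * (n + 1) \<le> 4 * n + 2 < 4 * (n + 1)\<close>, so \<open>j < 4\<close>.\<close>

lemma dvd_two_power_int_cases:
  fixes D :: int
  assumes "D ^ Suc n dvd 2 ^ (4 * n + 2)"
  shows "D \<in> {1, 2, 4, 8, -1, -2, -4, -8}"
proof -
  have "D dvd 2 ^ (4 * n + 2)"
    using assms by (metis dvd_mult_left power_Suc)
  then have "nat \<bar>D\<bar> dvd 2 ^ (4 * n + 2)"
    by (metis nat_abs_dvd_iff of_nat_numeral of_nat_power)
  then obtain j where j: "nat \<bar>D\<bar> = 2 ^ j"
    using divides_primepow_nat[OF two_is_prime_nat] by blast
  then have D: "\<bar>D\<bar> = 2 ^ j" by (metis abs_ge_zero int_nat_eq of_nat_numeral of_nat_power)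
  have "\<bar>D\<bar> ^ Suc n dvd 2 ^ (4 * n + 2)"
    using assms by (simp add: power_abs[symmetric] del: power_Suc)
  then have "(2::int) ^ (j * Suc n) dvd 2 ^ (4 * n + 2)"
    unfolding D by (simp only: power_mult)
  then have "(2::int) ^ (j * Suc n) \<le> 2 ^ (4 * n + 2)"
    by (rule zdvd_imp_le) simp
  then have "j * Suc n \<le> 4 * n + 2"
    by (rule power_le_imp_le_exp[rotated]) simp
  then have "j < 4"
    using mult_le_mono1[of 4 j "Suc n"] by (cases "j < 4") auto
  then have "j \<in> {0, 1, 2, 3}" by auto
  then have "\<bar>D\<bar> \<in> {1, 2, 4, 8}" unfolding D by auto
  then show ?thesis by auto
qed

lemma pell_quadratic_vanishing_at_0:
  fixes b c :: int
  assumes D: "b ^ 2 - 4 * c \<noteq> 0" and pell: "f ^ 2 - [:c, b, 1:] * h ^ 2 = 1"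
    and "h \<noteq> 0" "poly h 0 = 0"
  shows "(b, c) \<in> {(0, 1), (0, -1), (0, 2), (0, -2), (2, -1), (-2, -1)}"
proof -
  let ?z = "[:b, 2:]" and ?e = "[:c, b, 1:]" and ?D = "b ^ 2 - 4 * c"
  have "proportional_to_quad b c f h"
    using pell_solution_proportional_to_quad[OF D, of 1] pell by (simp add: one_pCons)
  then obtain m \<alpha> \<beta> where nz: "\<alpha> \<noteq> 0" "\<beta> \<noteq> 0" and f: "smult \<alpha> f = smult \<beta> (quad_A ?z ?e m)"
    and h: "smult \<alpha> h = smult \<beta> (quad_B ?z ?e m) \<or> smult \<alpha> h = - smult \<beta> (quad_B ?z ?e m)"
    unfolding proportional_to_quad_def by blast
  obtain n where m: "m = Suc n"
    using h \<open>h \<noteq> 0\<close> nz by (cases m) auto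
  have "[:\<alpha> ^ 2:] = smult (\<alpha> ^ 2) (f ^ 2 - ?e * h ^ 2)"
    unfolding pell by simp
  also have "\<dots> = (smult \<alpha> f) ^ 2 - ?e * (smult \<alpha> h) ^ 2"
    by (simp only: smult_diff_right smult_power mult_smult_right)
  also have "\<dots> = smult (\<beta> ^ 2) (quad_A ?z ?e m ^ 2 - ?e * quad_B ?z ?e m ^ 2)"
  proof -
    have "(smult \<alpha> h) ^ 2 = (smult \<beta> (quad_B ?z ?e m)) ^ 2"
      using h by auto
    then show ?thesis
      unfolding f by (simp only: smult_diff_right smult_power mult_smult_right)
  qed
  also have "\<dots> = [:\<beta> ^ 2 * ?D ^ m:]"
    unfolding quad_norm quad_discriminant by (simp add: poly_const_pow)
  finally have norm: "\<alpha> ^ 2 = \<beta> ^ 2 * ?D ^ m" by simp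
  \<comment> \<open>Integrality of \<open>f\<close> enters here: squaring this and inserting
    \<open>norm\<close> lets \<open>\<beta> ^ 2\<close> cancel.\<close>
  have "\<alpha> * coeff f m = \<beta> * 2 ^ (2 * n + 1)"
    using arg_cong[OF f, of "\<lambda>p. coeff p m"] degree_quad[of b c n] unfolding m coeff_smult
    by metis
  then have "\<alpha> ^ 2 dvd (\<beta> * 2 ^ (2 * n + 1)) ^ 2"
    by (metis dvd_triv_left dvd_power_same)
  also have "(\<beta> * 2 ^ (2 * n + 1)) ^ 2 = \<beta> ^ 2 * 2 ^ (4 * n + 2)"
    unfolding power_mult_distrib power_mult[symmetric] by (simp add: algebra_simps)
  finally have "?D ^ Suc n dvd 2 ^ (4 * n + 2)"
    unfolding norm m using nz by simp
  then have cases_D: "?D \<in> {1, 2, 4, 8, -1, -2, -4, -8}"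
    by (rule dvd_two_power_int_cases)
  have "poly (smult \<alpha> h) 0 = poly (smult \<beta> (quad_B ?z ?e m)) 0 \<or>
      poly (smult \<alpha> h) 0 = - poly (smult \<beta> (quad_B ?z ?e m)) 0"
    using h by (elim disjE) (simp_all only: poly_minus simp_thms)
  then have "poly (quad_B ?z ?e m) 0 = 0"
    using assms(4) nz by simp
  then have "quad_B b c (Suc n) = 0"
    by (simp add: poly_quad m del: quad_B.simps)
  then have bc: "b = 0 \<or> c < 0"
    using quad_B_nonzero[of b c n] by linarith
  \<comment> \<open>Otherwise \<open>c < 0\<close> and the discriminant is at least
    \<open>9 + 4 > 8\<close>.\<close>
  have "b \<in> {-2..2}"
  proof (rule ccontr)
    assume "b \<notin> {-2..2}"
    then have "3 \<le> \<bar>b\<bar>" "c < 0" using bc by auto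
    then have "3 ^ 2 \<le> b ^ 2" by (metis abs_le_square_iff abs_numeral)
    then show False using cases_D \<open>c < 0\<close> by auto
  qed
  then have "b \<in> {-2, -1, 0, 1, 2}" by auto
  moreover from this have "c \<in> {-2..3}"
    using cases_D by auto
  then have "c \<in> {-2, -1, 0, 1, 2, 3}" by auto
  \<comment> \<open>For \<open>b = 1\<close> or \<open>b = -1\<close> the discriminant
    \<open>1 - 4 * c\<close> would be 5 or 9; \<open>b = 2\<close> and \<open>b = -2\<close> leave
    \<open>c = -1\<close>.\<close>
  ultimately show ?thesis
    using cases_D bc by (elim insertE emptyE) simp_all
qed

section \<open>Reduction to the quadratic case\<close>

lemma pcompose_affine_inverse:
  fixes c s :: "'a::comm_ring_1"
  assumes "s * s = 1"
  shows "(p \<circ>\<^sub>p [:c, s:]) \<circ>\<^sub>p [:- c * s, s:] = p"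
proof -
  have "[:c, s:] \<circ>\<^sub>p [:- c * s, s:] = [:0, 1:]"
    using assms by (simp add: pcompose_pCons algebra_simps)
  then show ?thesis by (simp add: pcompose_assoc[symmetric])
qed

lemma pcompose_power: "(p ^ n) \<circ>\<^sub>p q = (p \<circ>\<^sub>p q) ^ n" for p q :: "'a::comm_ring_1 poly"
  by (induction n) (simp_all add: pcompose_mult pcompose_1)

lemma pellian_pcompose_imp:
  fixes d :: "'a::comm_ring_1 poly"
  assumes s: "s * s = 1" and "pellian d"
  shows "pellian (d \<circ>\<^sub>p [:c, s:])"
proof -
  let ?l = "[:c, s:]" and ?l' = "[:- c * s, s:]"
  obtain f g where nsq: "\<not> is_square d" and g: "g \<noteq> 0" and eq: "f ^ 2 - d * g ^ 2 = 1"
    using assms unfolding pellian_def by blast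
  have "\<not> is_square (d \<circ>\<^sub>p ?l)"
  proof
    assume "is_square (d \<circ>\<^sub>p ?l)"
    then obtain r where "d \<circ>\<^sub>p ?l = r ^ 2" by (auto elim: is_nth_powerE)
    then have "d = (r \<circ>\<^sub>p ?l') ^ 2"
      using pcompose_affine_inverse[OF s, of d c] by (simp add: pcompose_power)
    then show False using nsq by simp
  qed
  moreover have "g \<circ>\<^sub>p ?l \<noteq> 0"
    using pcompose_affine_inverse[OF s, of g c] g by auto
  moreover have "(f \<circ>\<^sub>p ?l) ^ 2 - (d \<circ>\<^sub>p ?l) * (g \<circ>\<^sub>p ?l) ^ 2 = 1"
    using arg_cong[OF eq, of "\<lambda>p. p \<circ>\<^sub>p ?l"]
    by (simp add: pcompose_diff pcompose_mult pcompose_power pcompose_1)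
  ultimately show ?thesis unfolding pellian_def by blast
qed

lemma pellian_pcompose_iff:
  fixes d :: "'a::comm_ring_1 poly"
  assumes "s * s = 1"
  shows "pellian (d \<circ>\<^sub>p [:c, s:]) \<longleftrightarrow> pellian d"
  using pellian_pcompose_imp[OF assms] pcompose_affine_inverse[OF assms] by metis

text \<open>A square cannot take a value strictly between consecutive squares. The absolute value
  also admits a negative \<open>poly d x\<close>, with \<open>n = 0\<close>.\<close>

lemma pellianI:
  fixes d :: "int poly"
  assumes "n ^ 2 < \<bar>poly d x\<bar>" "poly d x < (n + 1) ^ 2" "n \<ge> 0" "g \<noteq> 0" "f ^ 2 - d * g ^ 2 = 1"
  shows "pellian d"
proof -
  have "\<not> is_square d"
  proof
    assume "is_square d"
    then obtain r where "d = r ^ 2" by (auto elim: is_nth_powerE)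
    then have eq: "poly d x = \<bar>poly r x\<bar> ^ 2" by simp
    then have "n ^ 2 < \<bar>poly r x\<bar> ^ 2" "\<bar>poly r x\<bar> ^ 2 < (n + 1) ^ 2" using assms(1,2) by simp_all
    then have "n < \<bar>poly r x\<bar>" "\<bar>poly r x\<bar> < n + 1"
      using assms(3) by (simp_all only: power2_less_imp_less abs_ge_zero add_nonneg_nonneg zero_le_one)
    then show False by simp
  qed
  then show ?thesis using assms unfolding pellian_def by blast
qed

text \<open>For \<open>e = x^2 + a\<close> the first four solutions are
  \<open>(x + sqrt e)^2\<close> divided by the absolute value of \<open>a\<close>; the factor
  \<open>x\<close> of the second coordinate goes into \<open>d\<close>.\<close>

lemma pellian_list:
  "pellian (X^2 * (X^2 + 1))" "pellian (X^2 * (X^2 - 1))"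
  "pellian (X^2 * (X^2 + 2))" "pellian (X^2 * (X^2 - 2))"
  "pellian (X^2 * (X^2 - 2 * X - 1))"
proof -
  show "pellian (X^2 * (X^2 + 1))"
    by (rule pellianI[where x = 1 and n = 1 and g = 2 and f = "2 * X^2 + 1"])
      (simp_all add: power2_eq_square numeral_poly one_pCons)
  show "pellian (X^2 * (X^2 - 1))"
    by (rule pellianI[where x = 2 and n = 3 and g = 2 and f = "2 * X^2 - 1"])
      (simp_all add: power2_eq_square numeral_poly one_pCons)
  show "pellian (X^2 * (X^2 + 2))"
    by (rule pellianI[where x = 1 and n = 1 and g = 1 and f = "X^2 + 1"])
      (simp_all add: power2_eq_square numeral_poly one_pCons)
  show "pellian (X^2 * (X^2 - 2))"
    by (rule pellianI[where x = 1 and n = 0 and g = 1 and f = "X^2 - 1"])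
      (simp_all add: power2_eq_square numeral_poly one_pCons)
  \<comment> \<open>With \<open>y = x - 1\<close> the quadratic is \<open>y^2 - 2\<close>, solved by
    \<open>(y^2 - 1) + y sqrt e\<close>. Its square has second coordinate
    \<open>2 y (y^2 - 1) = 2 x (x - 1) (x - 2)\<close>, which vanishes at 0.\<close>
  show "pellian (X^2 * (X^2 - 2 * X - 1))"
    by (rule pellianI[where x = 1 and n = 0 and g = "2 * (X - 1) * (X - 2)"
          and f = "2 * (X - 1)^4 - 4 * (X - 1)^2 + 1"])
      (simp_all add: power2_eq_square eval_nat_numeral numeral_poly one_pCons)
qed

text \<open>Since \<open>d\<close> is monic, a repeated factor \<open>p\<close> has leading
  coefficient 1 or -1, so it is not constant; degree 2 would make \<open>d = p ^ 2\<close>. Hence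
  \<open>p\<close> is linear, and its root \<open>a\<close> is moved to 0.\<close>

lemma not_squarefree_quartic_cases:
  fixes d :: "int poly"
  assumes "lead_coeff d = 1" "degree d = 4" "\<not> squarefree d" "\<not> is_square d"
  obtains a b c where "d \<circ>\<^sub>p [:a, 1:] = X ^ 2 * [:c, b, 1:]"
proof -
  obtain p where p: "p ^ 2 dvd d" "\<not> is_unit p"
    using assms(3) unfolding squarefree_def by blast
  then obtain r where d: "d = p ^ 2 * r" by blast
  have "d \<noteq> 0" using assms by auto
  then have nz: "p \<noteq> 0" "r \<noteq> 0" using d by auto
  have lead: "lead_coeff p ^ 2 * lead_coeff r = 1"
    using assms(1) unfolding d lead_coeff_mult lead_coeff_power .
  then have "lead_coeff p dvd 1"
    by (metis dvd_triv_left power2_eq_square mult.assoc)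
  then have lp: "lead_coeff p = 1 \<or> lead_coeff p = -1" by auto
  then have lr: "lead_coeff r = 1" using lead by auto
  have deg: "2 * degree p + degree r = 4"
    using assms(2) nz unfolding d by (simp add: degree_mult_eq degree_power_eq)
  have "degree p \<noteq> 0"
  proof
    assume "degree p = 0"
    then obtain u where "p = [:u:]" by (rule degree_eq_zeroE)
    then show False using lp p(2) by (auto simp: is_unit_const_poly_iff)
  qed
  moreover have "degree p \<noteq> 2"
  proof
    assume "degree p = 2"
    then have "degree r = 0" using deg by simp
    then have "r = 1" using lr by (auto elim!: degree_eq_zeroE)
    then show False using assms(4) d by simp
  qed
  ultimately have degp: "degree p = 1" and degr: "degree r = 2" using deg by linarith+
  obtain u s where us: "p = [:u, s:]" and s: "s = 1 \<or> s = -1"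
  proof
    show "p = [:coeff p 0, coeff p 1:]"
      using degp by (intro poly_eqI) (auto simp: coeff_pCons coeff_eq_0 split: nat.split)
    show "coeff p 1 = 1 \<or> coeff p 1 = -1" using lp degp by simp
  qed
  define a where "a = - s * u"
  define r' where "r' = r \<circ>\<^sub>p [:a, 1:]"
  have "degree r' = 2"
    unfolding r'_def using degr by (simp add: degree_pcompose)
  moreover have "lead_coeff r' = 1"
    unfolding r'_def using lr by (subst lead_coeff_comp) simp_all
  ultimately have r': "r' = [:coeff r' 0, coeff r' 1, 1:]"
    by (intro poly_eqI) (auto simp: coeff_pCons coeff_eq_0 numeral_2_eq_2 split: nat.split)
  have "p \<circ>\<^sub>p [:a, 1:] = [:0, s:]"
    unfolding us a_def using s by (auto simp: pcompose_pCons)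
  then have "(p \<circ>\<^sub>p [:a, 1:]) ^ 2 = X ^ 2"
    using s by (auto simp: power2_eq_square)
  then have "d \<circ>\<^sub>p [:a, 1:] = X ^ 2 * r'"
    unfolding d r'_def pcompose_mult pcompose_power by simp
  then show thesis using r' that by metis
qed

text \<open>Absorbing \<open>X\<close> into \<open>h = X * g\<close> gives the vanishing at 0;
  discriminant zero would make the quartic a square.\<close>

lemma pellian_X_square_times_quadratic:
  assumes "pellian (X ^ 2 * [:c, b, 1:])"
  shows "(b, c) \<in> {(0, 1), (0, -1), (0, 2), (0, -2), (2, -1), (-2, -1)}"
proof -
  obtain f g where nsq: "\<not> is_square (X ^ 2 * [:c, b, 1:])" and "g \<noteq> 0"
    and eq: "f ^ 2 - X ^ 2 * [:c, b, 1:] * g ^ 2 = 1"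
    using assms unfolding pellian_def by blast
  have "b ^ 2 - 4 * c \<noteq> 0"
  proof
    assume D: "b ^ 2 - 4 * c = 0"
    then have "even (b ^ 2)" by simp
    then obtain k where k: "b = 2 * k" by auto
    then have "c = k ^ 2" using D by (simp add: power_mult_distrib)
    then have "X ^ 2 * [:c, b, 1:] = (X * [:k, 1:]) ^ 2"
      using k by (simp add: power2_eq_square)
    then show False using nsq by simp
  qed
  moreover have "f ^ 2 - [:c, b, 1:] * (X * g) ^ 2 = 1"
    using eq by (simp only: power_mult_distrib mult_ac)
  ultimately show ?thesis
    by (rule pell_quadratic_vanishing_at_0) (use \<open>g \<noteq> 0\<close> in auto)
qed

theorem theorem1p2:
  fixes d :: "int poly"
  assumes "lead_coeff d = 1" and "degree d = 4" and "\<not> squarefree d"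
  shows "pellian d \<longleftrightarrow>
    (\<exists>q \<in> {X^2 * (X^2 + 1), X^2 * (X^2 - 1),
           X^2 * (X^2 + 2), X^2 * (X^2 - 2),
           X^2 * (X^2 - 2 * X - 1)}.
       equal_up_to_change_of_variables d q)"
proof
  assume pell: "pellian d"
  then have "\<not> is_square d" unfolding pellian_def by blast
  then obtain a b c where d: "d \<circ>\<^sub>p [:a, 1:] = X ^ 2 * [:c, b, 1:]"
    using not_squarefree_quartic_cases assms by metis
  have "pellian (X ^ 2 * [:c, b, 1:])"
    using pellian_pcompose_iff[of 1 d a] pell unfolding d by simp
  then have bc: "(b, c) \<in> {(0, 1), (0, -1), (0, 2), (0, -2), (2, -1), (-2, -1)}"
    by (rule pellian_X_square_times_quadratic)
  \<comment> \<open>Reflection flips the sign of \<open>b\<close>, which identifies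
    \<open>(2, -1)\<close> with the listed \<open>(-2, -1)\<close>.\<close>
  have "d \<circ>\<^sub>p [:a, -1:] = (d \<circ>\<^sub>p [:a, 1:]) \<circ>\<^sub>p [:0, -1:]"
    by (simp add: pcompose_assoc[symmetric] pcompose_pCons)
  also have "\<dots> = X ^ 2 * [:c, - b, 1:]"
    unfolding d by (simp add: pcompose_mult pcompose_power pcompose_pCons power2_eq_square)
  finally have eq: "equal_up_to_change_of_variables d (X ^ 2 * [:c, b, 1:])"
      "equal_up_to_change_of_variables d (X ^ 2 * [:c, - b, 1:])"
    unfolding equal_up_to_change_of_variables_def using d by blast+
  have forms: "X^2 + 1 = [:1, 0, 1:]" "X^2 - 1 = [:-1, 0, 1:]" "X^2 + 2 = [:2, 0, 1:]"
    "X^2 - 2 = [:-2, 0, 1:]" "X^2 - 2 * X - 1 = [:-1, -2, 1:]"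
    by (simp_all add: power2_eq_square numeral_poly one_pCons)
  show "\<exists>q \<in> {X^2 * (X^2 + 1), X^2 * (X^2 - 1), X^2 * (X^2 + 2), X^2 * (X^2 - 2),
           X^2 * (X^2 - 2 * X - 1)}. equal_up_to_change_of_variables d q"
    unfolding forms using bc eq by auto
next
  assume "\<exists>q \<in> {X^2 * (X^2 + 1), X^2 * (X^2 - 1), X^2 * (X^2 + 2), X^2 * (X^2 - 2),
           X^2 * (X^2 - 2 * X - 1)}. equal_up_to_change_of_variables d q"
  then obtain q where q: "pellian q" "equal_up_to_change_of_variables d q"
    using pellian_list by blast
  then obtain c s where "s \<in> {1, -1}" "d \<circ>\<^sub>p [:c, s:] = q"
    unfolding equal_up_to_change_of_variables_def by blast
  then show "pellian d"
    using pellian_pcompose_iff[of s d c] q(1) by auto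
qed

end
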